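(* For every integer $n\geq3$, the chromatic number of $\mathcal{S}'(\mathbb{R},n)$ is infinite, i.e., $\chi(\mathcal{S}'(\mathbb{R},n))=\infty$.
   Context: For $x,y\in\mathbb{R}^n$, $\langle x,y\rangle$ is the standard inner product; $U^\perp$ is the orthogonal complement of a subspace $U$. $\mathcal{S}'(\mathbb{R},n)$ is the graph whose vertices are all pairs $(U,W)$ of subspaces of $\mathbb{R}^n$, two distinct pairs $(U_1,W_1),(U_2,W_2)$ being adjacent iff there exist $u,w$ with $\langle u,w\rangle\neq0$, $u\in U_1\cap W_2^{\perp}$, $w\in W_1\cap U_2^{\perp}$, and there exist $u',w'$ with $\langle u',w'\rangle\ne0$, $u'\in U_2\cap W_1^{\perp}$, $w'\in W_2\cap U_1^{\perp}$. $\chi=\infty$ means no proper coloring with finitely many colors exists. *)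

theory Defs
  imports "HOL-Analysis.Analysis" "HOL-Library.Extended_Nat"
begin

definition proper_coloring :: "'v set \<Rightarrow> ('v \<Rightarrow> 'v \<Rightarrow> bool) \<Rightarrow> nat \<Rightarrow> ('v \<Rightarrow> nat) \<Rightarrow> bool"
  where "proper_coloring V adj k c \<longleftrightarrow>
    c ` V \<subseteq> {..<k} \<and> (\<forall>x\<in>V. \<forall>y\<in>V. adj x y \<longrightarrow> c x \<noteq> c y)"

(* The infimum of the empty set in enat is \<infinity>, so the value is \<infinity> exactly when there is no
   proper coloring with finitely many colors; infinite cardinals are not distinguished. *)
definition chromatic_number :: "'v set \<Rightarrow> ('v \<Rightarrow> 'v \<Rightarrow> bool) \<Rightarrow> enat"
  where "chromatic_number V adj = Inf {enat k | k. \<exists>c. proper_coloring V adj k c}"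

definition S'_verts :: "((real ^ 'n) set \<times> (real ^ 'n) set) set"
  where "S'_verts = {(U, W). subspace U \<and> subspace W}"

definition S'_adj ::
    "(real ^ 'n) set \<times> (real ^ 'n) set \<Rightarrow> (real ^ 'n) set \<times> (real ^ 'n) set \<Rightarrow> bool"
  where "S'_adj = (\<lambda>(U1, W1) (U2, W2).
    (U1, W1) \<noteq> (U2, W2) \<and>
    (\<exists>u w. u \<bullet> w \<noteq> 0 \<and> u \<in> U1 \<inter> orthogonal_comp W2 \<and> w \<in> W1 \<inter> orthogonal_comp U2) \<and>
    (\<exists>u' w'. u' \<bullet> w' \<noteq> 0 \<and> u' \<in> U2 \<inter> orthogonal_comp W1 \<and> w' \<in> W2 \<inter> orthogonal_comp U1))"

end

theory Submission
  imports Defs "HOL-Library.Ramsey"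
begin

text \<open>
  Put points \<open>q t = (1, t, t\<^sup>2)\<close> on the moment curve in a coordinate 3-space, and let
  \<open>m a b = (a b, - a - b, 1)\<close>, so that \<open>q t \<bullet> m a b = (t - a) (t - b)\<close>: the vector \<open>m a b\<close> is
  normal to the plane through \<open>q a\<close> and \<open>q b\<close> and to no other \<open>q t\<close>. Send a triple
  \<open>a < b < c\<close> to the vertex \<open>(span {q b}, span {m a c})\<close>. Consecutive triples \<open>(a, b, c)\<close> and
  \<open>(b, c, d)\<close> then get adjacent vertices, so the graph contains the shift graph on triples,
  which has no finite coloring by Ramsey's theorem.
\<close>

lemma chromatic_number_eq_infinity:
  assumes "\<And>k c. \<not> proper_coloring V adj k c"
  shows "chromatic_number V adj = \<infinity>"
proof -
  have "{enat k | k. \<exists>c. proper_coloring V adj k c} = {}"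
    using assms by blast
  then show ?thesis
    by (simp add: chromatic_number_def Inf_enat_def)
qed

lemma shift_graph_triples_not_finitely_colorable:
  fixes f :: "nat \<Rightarrow> nat \<Rightarrow> nat \<Rightarrow> nat"
  assumes "\<And>x y z. f x y z < k"
  obtains a b c d where "a < b" "b < c" "c < d" "f a b c = f b c d"
proof -
  \<comment> \<open>Ramsey's theorem colors unordered 3-sets; \<open>g\<close> feeds the elements to
    \<open>f\<close> in increasing order.\<close>
  define g where
    "g X = (let l = sorted_list_of_set X in f (l ! 0) (l ! 1) (l ! 2))" for X
  have g: "g {x, y, z} = f x y z" if "x < y" "y < z" for x y z
  proof -
    have "sorted_list_of_set {x, y, z} = [x, y, z]"
      using that by (intro sorted_distinct_set_unique) auto
    then show ?thesis by (simp add: g_def)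
  qed
  have "\<forall>X. X \<subseteq> UNIV \<and> finite X \<and> card X = 3 \<longrightarrow> g X < k"
    using assms by (simp add: g_def Let_def)
  from Ramsey[OF infinite_UNIV_nat this] obtain Y t where Y: "infinite Y"
    and t: "\<forall>X. X \<subseteq> Y \<and> finite X \<and> card X = 3 \<longrightarrow> g X = t"
    by (elim exE conjE)
  define e where "e = enumerate Y"
  have e: "e i < e j" if "i < j" for i j
    using that Y by (simp add: e_def)
  have f: "f (e i) (e j) (e l) = t" if "i < j" "j < l" for i j l
  proof -
    have "e i < e j" "e j < e l" using that e by auto
    moreover have "{e i, e j, e l} \<subseteq> Y"
      using enumerate_in_set[OF Y] by (simp add: e_def)
    ultimately show ?thesis
      using t[rule_format, of "{e i, e j, e l}"] g by simp
  qed
  \<comment> \<open>The overlapping triples of four successive elements of the homogeneous set both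
    get color \<open>t\<close>.\<close>
  show ?thesis
    by (rule that[of "e 0" "e 1" "e 2" "e 3"]) (simp_all add: e f)
qed

lemma S'_adj_span_singletons:
  fixes u1 u2 w1 w2 :: "real ^ 'n"
  assumes "u1 \<bullet> w1 \<noteq> 0" "u2 \<bullet> w2 \<noteq> 0" "u1 \<bullet> w2 = 0" "u2 \<bullet> w1 = 0"
  shows "S'_adj (span {u1}, span {w1}) (span {u2}, span {w2})"
proof -
  have perp: "x \<in> orthogonal_comp (span {y})" if "x \<bullet> y = 0" for x y :: "real ^ 'n"
    using that by (auto simp: orthogonal_comp_def span_singleton orthogonal_def inner_commute)
  have in_span: "x \<in> span {x}" for x :: "real ^ 'n"
    by (simp add: span_base)
  \<comment> \<open>The first components already differ: on a common line \<open>u1\<close> would be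
    a multiple of \<open>u2\<close>, so \<open>u2 \<bullet> w1 = 0\<close> would force
    \<open>u1 \<bullet> w1 = 0\<close>.\<close>
  have "span {u1} \<noteq> span {u2}"
  proof
    assume "span {u1} = span {u2}"
    then obtain r where "u1 = r *\<^sub>R u2"
      using in_span[of u1] by (auto simp: span_singleton)
    then show False using assms by simp
  qed
  then have "(span {u1}, span {w1}) \<noteq> (span {u2}, span {w2})"
    by simp
  moreover have "u1 \<in> span {u1} \<inter> orthogonal_comp (span {w2})"
      "u2 \<in> span {u2} \<inter> orthogonal_comp (span {w1})"
      "w1 \<in> span {w1} \<inter> orthogonal_comp (span {u2})"
      "w2 \<in> span {w2} \<inter> orthogonal_comp (span {u1})"
    using assms in_span perp by (simp_all add: inner_commute)
  ultimately show ?thesis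
    unfolding S'_adj_def prod.case using assms(1,2) by (intro conjI exI)
qed

lemma moment_curve_vectors:
  assumes "CARD('n::finite) \<ge> 3"
  obtains q :: "real \<Rightarrow> real ^ 'n" and m :: "real \<Rightarrow> real \<Rightarrow> real ^ 'n"
  where "\<And>t a b. q t \<bullet> m a b = (t - a) * (t - b)"
proof -
  \<comment> \<open>The dimension bound provides the three distinct axes that carry the
    curve.\<close>
  obtain I :: "'n set" where "card I = 3"
    using obtain_subset_with_card_n[OF assms] by blast
  then obtain i j k :: 'n where ijk: "i \<noteq> j" "i \<noteq> k" "j \<noteq> k"
    by (auto simp: card_3_iff)
  define q :: "real \<Rightarrow> real ^ 'n" where "q t = axis i 1 + axis j t + axis k (t\<^sup>2)" for t
  define m :: "real \<Rightarrow> real \<Rightarrow> real ^ 'n"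
    where "m a b = axis i (a * b) + axis j (- a - b) + axis k 1" for a b
  have "q t \<bullet> m a b = (t - a) * (t - b)" for t a b
    using ijk by (simp add: q_def m_def inner_add_left inner_add_right inner_axis_axis
        algebra_simps power2_eq_square)
  then show ?thesis by (rule that)
qed

theorem theorem3p14:
  assumes "CARD('n::finite) \<ge> 3"
  shows "chromatic_number (S'_verts :: ((real ^ 'n) set \<times> (real ^ 'n) set) set) S'_adj = \<infinity>"
proof (rule chromatic_number_eq_infinity, rule notI)
  fix k and col :: "(real ^ 'n) set \<times> (real ^ 'n) set \<Rightarrow> nat"
  assume col: "proper_coloring S'_verts S'_adj k col"
  obtain q :: "real \<Rightarrow> real ^ 'n" and m where qm: "\<And>t a b. q t \<bullet> m a b = (t - a) * (t - b)"
    using moment_curve_vectors[OF assms] by blast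
  define v where
    "v a b c = (span {q (real b)}, span {m (real a) (real c)})" for a b c :: nat
  have v: "v a b c \<in> S'_verts" for a b c
    by (simp add: v_def S'_verts_def)
  then have "col (v a b c) < k" for a b c
    using col by (simp add: proper_coloring_def image_subset_iff)
  then obtain a b c d where abcd: "a < b" "b < c" "c < d" "col (v a b c) = col (v b c d)"
    by (rule shift_graph_triples_not_finitely_colorable)
  \<comment> \<open>The nonzero products are \<open>(b - a) * (b - c)\<close> and
    \<open>(c - b) * (c - d)\<close>; the mixed ones vanish since \<open>b\<close> is a root for
    \<open>m b d\<close> and \<open>c\<close> for \<open>m a c\<close>.\<close>
  have "S'_adj (v a b c) (v b c d)"
    unfolding v_def using abcd by (intro S'_adj_span_singletons) (simp_all add: qm)
  then show False
    using col v abcd(4) by (auto simp: proper_coloring_def)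
qed

end
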